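(* Let $\mathcal G=(G_n,\|\cdot\|_n)_{n\in\mathbb N}$ be a family of metric groups with $\|\cdot\|_n\le1$ for all $n$, and let $\mathcal U$ be a non-principal ultrafilter on $\mathbb N$. If the metric ultraproduct $\mathcal G^*_{\mathrm{met}}$ is simple and has the $(\star)$-property (as a one-member family of groups), then $\mathcal G^*_{\mathrm{met}}$ is metrically uniformly simple.
   Context: A metric group $(G,\|\cdot\|)$ is a group with a bi-invariant norm: $\|e\|=0$, $\|gh\|\le\|g\|+\|h\|$, $\|g^{-1}\|=\|g\|=\|hgh^{-1}\|$, and $\|g\|=0$ iff $g=e$. The metric ultraproduct is $\mathcal G^*_{\mathrm{met}}=\prod_{n}G_n/\mathcal E$, $\mathcal E=\{(g_n) : \lim_{n\to\mathcal U}\|g_n\|_n=0\}$, with norm $\|(g_n)/\mathcal E\|=\lim_{n\to\mathcal U}\|g_n\|_n$. $C_N(g,G)$ is the set of all products of at most $N$ conjugates (in $G$) of $g$ and $g^{-1}$, and $N(g,G)=\min\{n\in\mathbb N : C_n(g,G)=G\}$ (with value $\infty$ if there is no such $n$). A family of groups $\mathcal G$ has the $(\star)$-property if: (1) there is $N\in\mathbb N$ such that for any $G\in\mathcal G$ there is $g\in G$ with $C_N(g,G)=G$; and (2) for any $k\in\mathbb N$ there is $l\in\mathbb N$ such that for any $G\in\mathcal G$ and $g,h\in G$, if $N(g,G),N(h,G)\ge l$ then $N(gh,G)\ge k$. A group with (pseudo-)norm $(G,\|\cdot\|)$ is metrically uniformly simple if for all $t>r>0$ there is $N\in\mathbb N$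 such that $C_N(g,G)\supseteq\{h\in G : \|h\|<t\}$ for all $g\in G$ with $\|g\|\in(r,t]$. *)

theory Defs
  imports "HOL-Analysis.Elementary_Topology" "HOL-Library.Extended_Nat" "HOL-Algebra.Product_Groups"
begin

locale metric_group = group G for G (structure) +
  fixes nrm :: "'a \<Rightarrow> real"
  assumes nrm_one: "nrm \<one> = 0"
    and nrm_mult: "\<lbrakk>g \<in> carrier G; h \<in> carrier G\<rbrakk> \<Longrightarrow> nrm (g \<otimes> h) \<le> nrm g + nrm h"
    and nrm_inv: "g \<in> carrier G \<Longrightarrow> nrm (inv g) = nrm g"
    and nrm_conj: "\<lbrakk>g \<in> carrier G; h \<in> carrier G\<rbrakk> \<Longrightarrow> nrm (h \<otimes> g \<otimes> inv h) = nrm g"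
    and nrm_eq_0_iff: "g \<in> carrier G \<Longrightarrow> nrm g = 0 \<longleftrightarrow> g = \<one>"

definition ultrafilter :: "'i filter \<Rightarrow> bool" where
  "ultrafilter U \<longleftrightarrow>
     U \<noteq> bot \<and> (\<forall>P. eventually P U \<or> eventually (\<lambda>i. \<not> P i) U)"

definition nonprincipal_ultrafilter :: "'i filter \<Rightarrow> bool" where
  "nonprincipal_ultrafilter U \<longleftrightarrow> ultrafilter U \<and> (\<forall>i. U \<noteq> principal {i})"

definition null_sequences ::
  "(nat \<Rightarrow> ('a, 'b) monoid_scheme) \<Rightarrow> (nat \<Rightarrow> 'a \<Rightarrow> real) \<Rightarrow> nat filter \<Rightarrow> (nat \<Rightarrow> 'a) set" where
  "null_sequences G nrm U =
     {g \<in> carrier (product_group UNIV G). ((\<lambda>n. nrm n (g n)) \<longlongrightarrow> 0) U}"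

definition metric_ultraproduct ::
  "(nat \<Rightarrow> ('a, 'b) monoid_scheme) \<Rightarrow> (nat \<Rightarrow> 'a \<Rightarrow> real) \<Rightarrow> nat filter \<Rightarrow> (nat \<Rightarrow> 'a) set monoid" where
  "metric_ultraproduct G nrm U = product_group UNIV G Mod null_sequences G nrm U"

text \<open>Elements of the ultraproduct are cosets of sequences. For metric groups with norms
  bounded by \<open>1\<close>, all representatives of a coset have the same norm limit along an
  ultrafilter; see \<open>metric_ultraproduct_norm_coset\<close> below.\<close>

definition metric_ultraproduct_norm ::
  "(nat \<Rightarrow> 'a \<Rightarrow> real) \<Rightarrow> nat filter \<Rightarrow> (nat \<Rightarrow> 'a) set \<Rightarrow> real" where
  "metric_ultraproduct_norm nrm U x = (THE r. \<forall>g\<in>x. ((\<lambda>n. nrm n (g n)) \<longlongrightarrow> r) U)"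

definition conjugates_pm :: "('a, 'b) monoid_scheme \<Rightarrow> 'a \<Rightarrow> 'a set" where
  "conjugates_pm G g =
     {h \<otimes>\<^bsub>G\<^esub> x \<otimes>\<^bsub>G\<^esub> inv\<^bsub>G\<^esub> h | h x. h \<in> carrier G \<and> x \<in> {g, inv\<^bsub>G\<^esub> g}}"

text \<open>The empty product is allowed, so \<open>C_set G N g\<close> always contains the identity.\<close>

definition C_set :: "('a, 'b) monoid_scheme \<Rightarrow> nat \<Rightarrow> 'a \<Rightarrow> 'a set" where
  "C_set G N g =
     {foldr (\<otimes>\<^bsub>G\<^esub>) xs \<one>\<^bsub>G\<^esub> | xs. length xs \<le> N \<and> set xs \<subseteq> conjugates_pm G g}"

text \<open>The infimum of the empty set in \<^typ>\<open>enat\<close> is \<open>\<infinity>\<close>.\<close>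

definition N_num :: "('a, 'b) monoid_scheme \<Rightarrow> 'a \<Rightarrow> enat" where
  "N_num G g = Inf {enat n | n. C_set G n g = carrier G}"

definition star_property :: "('a, 'b) monoid_scheme set \<Rightarrow> bool" where
  "star_property \<G> \<longleftrightarrow>
     (\<exists>N. \<forall>G\<in>\<G>. \<exists>g\<in>carrier G. C_set G N g = carrier G) \<and>
     (\<forall>k::nat. \<exists>l::nat. \<forall>G\<in>\<G>. \<forall>g\<in>carrier G. \<forall>h\<in>carrier G.
        N_num G g \<ge> enat l \<and> N_num G h \<ge> enat l \<longrightarrow> N_num G (g \<otimes>\<^bsub>G\<^esub> h) \<ge> enat k)"

definition metrically_uniformly_simple :: "('a, 'b) monoid_scheme \<Rightarrow> ('a \<Rightarrow> real) \<Rightarrow> bool" where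
  "metrically_uniformly_simple G nrm \<longleftrightarrow>
     (\<forall>t r::real. t > r \<and> r > 0 \<longrightarrow>
        (\<exists>N. \<forall>g\<in>carrier G. nrm g \<in> {r<..t} \<longrightarrow> {h \<in> carrier G. nrm h < t} \<subseteq> C_set G N g))"

text \<open>The locale \<open>simple_group\<close> of \<open>HOL-Algebra\<close> requires \<open>order G > 1\<close>; as
  \<^const>\<open>order\<close> is \<open>0\<close> for infinite groups, it only covers finite simple groups.\<close>

definition is_simple :: "('a, 'b) monoid_scheme \<Rightarrow> bool" where
  "is_simple G \<longleftrightarrow> group G \<and> carrier G \<noteq> {\<one>\<^bsub>G\<^esub>} \<and>
     (\<forall>H. H \<lhd> G \<longrightarrow> H = carrier G \<or> H = {\<one>\<^bsub>G\<^esub>})"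

lemma (in metric_group) nrm_nonneg:
  assumes "g \<in> carrier G" shows "nrm g \<ge> 0"
  using nrm_mult[of g "inv g"] nrm_inv[of g] nrm_one assms by simp

lemma ultrafilter_bounded_limit:
  fixes f :: "'i \<Rightarrow> real"
  assumes U: "ultrafilter U" and f: "\<And>i. a \<le> f i \<and> f i \<le> b"
  shows "\<exists>l. (f \<longlongrightarrow> l) U"
proof -
  have "filtermap f U \<noteq> bot" using U by (simp add: ultrafilter_def filtermap_bot_iff)
  moreover have "eventually (\<lambda>x. x \<in> {a..b}) (filtermap f U)" using f by (simp add: eventually_filtermap)
  ultimately obtain l where l: "inf (nhds l) (filtermap f U) \<noteq> bot"
    using compact_Icc[of a b] unfolding compact_filter by blast
  have "eventually (\<lambda>i. P (f i)) U" if P: "eventually P (nhds l)" for P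
  proof (rule ccontr)
    assume "\<not> ?thesis"
    then have "eventually (\<lambda>i. \<not> P (f i)) U" using U by (auto simp: ultrafilter_def)
    then have "eventually (\<lambda>x. \<not> P x) (filtermap f U)" by (simp add: eventually_filtermap)
    with P have "eventually (\<lambda>x. False) (inf (nhds l) (filtermap f U))"
      unfolding eventually_inf by blast
    with l show False by (simp add: trivial_limit_def)
  qed
  then have "(f \<longlongrightarrow> l) U" by (simp add: filterlim_iff)
  then show ?thesis ..
qed

lemma metric_ultraproduct_norm_coset:
  assumes mg: "\<And>n. metric_group (G n) (nrm n)"
    and bd: "\<And>n g. g \<in> carrier (G n) \<Longrightarrow> nrm n g \<le> 1"
    and U: "ultrafilter U" and g: "g \<in> carrier (product_group UNIV G)"
  shows "((\<lambda>n. nrm n (g n)) \<longlongrightarrow>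
            metric_ultraproduct_norm nrm U (null_sequences G nrm U #>\<^bsub>product_group UNIV G\<^esub> g)) U"
proof -
  let ?x = "null_sequences G nrm U #>\<^bsub>product_group UNIV G\<^esub> g"
  have gr: "group (G n)" for n using mg metric_group.axioms(1) by blast
  have gc: "g n \<in> carrier (G n)" for n using g by auto
  obtain l where l: "((\<lambda>n. nrm n (g n)) \<longlongrightarrow> l) U"
    using ultrafilter_bounded_limit[OF U, of 0 "\<lambda>n. nrm n (g n)" 1]
      bd gc metric_group.nrm_nonneg[OF mg] by blast
  have all: "((\<lambda>n. nrm n (h n)) \<longlongrightarrow> l) U" if h: "h \<in> ?x" for h
  proof -
    obtain e where e: "e \<in> null_sequences G nrm U" and he: "h = (\<lambda>n. e n \<otimes>\<^bsub>G n\<^esub> g n)"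
      using h by (auto simp: r_coset_def product_group_def restrict_def)
    have ec: "e n \<in> carrier (G n)" and e0: "((\<lambda>n. nrm n (e n)) \<longlongrightarrow> 0) U" for n
      using e by (auto simp: null_sequences_def)
    have "\<bar>nrm n (h n) - nrm n (g n)\<bar> \<le> nrm n (e n)" for n
    proof -
      interpret metric_group "G n" "nrm n" by (rule mg)
      have "g n = inv\<^bsub>G n\<^esub> e n \<otimes>\<^bsub>G n\<^esub> h n" using ec gc by (simp add: he m_assoc[symmetric])
      then have "nrm n (g n) \<le> nrm n (e n) + nrm n (h n)"
        using nrm_mult[of "inv\<^bsub>G n\<^esub> e n" "h n"] ec gc by (simp add: he nrm_inv)
      moreover have "nrm n (h n) \<le> nrm n (e n) + nrm n (g n)"
        using nrm_mult ec gc by (simp add: he)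
      ultimately show ?thesis by linarith
    qed
    then have "((\<lambda>n. nrm n (h n) - nrm n (g n)) \<longlongrightarrow> 0) U"
      by (intro tendsto_0_le[OF e0, where K = 1] always_eventually) (auto intro: order_trans[OF _ abs_ge_self])
    from tendsto_add[OF this l] show ?thesis by simp
  qed
  have one: "(\<lambda>n. \<one>\<^bsub>G n\<^esub>) \<in> null_sequences G nrm U"
    using gr mg by (auto simp: null_sequences_def metric_group.nrm_one group.is_monoid)
  have "(\<lambda>n. \<one>\<^bsub>G n\<^esub> \<otimes>\<^bsub>G n\<^esub> g n) \<in> ?x"
    using one by (force simp: r_coset_def product_group_def restrict_def)
  moreover have "(\<lambda>n. \<one>\<^bsub>G n\<^esub> \<otimes>\<^bsub>G n\<^esub> g n) = g"
    using gc gr by (simp add: group.is_monoid)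
  ultimately have gx: "g \<in> ?x" by simp
  have "U \<noteq> bot" using U by (simp add: ultrafilter_def)
  then have "metric_ultraproduct_norm nrm U ?x = l"
    unfolding metric_ultraproduct_norm_def
    using all gx l by (intro the_equality) (auto intro: tendsto_unique)
  with l show ?thesis by simp
qed

end

theory Submission
  imports Defs
begin

text \<open>Fix \<open>a\<close> with \<open>N(a) < \<infinity>\<close>, and suppose that there are elements \<open>g\<^sub>k\<close> of norm greater
  than \<open>r\<close> with \<open>N(g\<^sub>k) \<rightarrow> \<infinity>\<close>. By the star property, products of \<open>M\<close> conjugates of \<open>g\<^sub>k\<close> have
  large \<open>N\<close> once \<open>k\<close> is large, so that if \<open>a = s x\<close> with \<open>x\<close> such a product, then \<open>N(s) < l\<close> for
  some \<open>l\<close> not depending on \<open>M\<close>. Then every element of the group has norm at most \<open>l \<parallel>s\<parallel>\<close>, which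
  keeps \<open>\<parallel>s\<parallel>\<close> away from \<open>0\<close>. So \<open>a\<close> has a distance from \<open>C\<^sub>M(g\<^sub>k)\<close> that is bounded below
  uniformly in \<open>M\<close>. A diagonal sequence of the \<open>g\<^sub>k\<close> then represents an element \<open>g \<noteq> 1\<close> with
  \<open>a \<notin> C\<^sub>M(g)\<close> for all \<open>M\<close>, against simplicity.\<close>

section \<open>Products of conjugates\<close>

lemma conjugates_pmE:
  assumes "c \<in> conjugates_pm G g"
  obtains h x where "h \<in> carrier G" "x = g \<or> x = inv\<^bsub>G\<^esub> g" "c = h \<otimes>\<^bsub>G\<^esub> x \<otimes>\<^bsub>G\<^esub> inv\<^bsub>G\<^esub> h"
  using assms by (auto simp: conjugates_pm_def)

lemma conjugates_pmI:
  "h \<in> carrier G \<Longrightarrow> x = g \<or> x = inv\<^bsub>G\<^esub> g \<Longrightarrow> h \<otimes>\<^bsub>G\<^esub> x \<otimes>\<^bsub>G\<^esub> inv\<^bsub>G\<^esub> h \<in> conjugates_pm G g"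
  by (auto simp: conjugates_pm_def)

lemma C_set_0: "C_set G 0 g = {\<one>\<^bsub>G\<^esub>}"
  by (auto simp: C_set_def)

lemma one_in_C_set: "\<one>\<^bsub>G\<^esub> \<in> C_set G n g"
  unfolding C_set_def by (rule CollectI, rule exI[of _ "[]"]) simp

text \<open>Recursion on the list of factors, the basis of all inductions on \<open>C_set\<close>.
  The first disjunct is the empty list; for \<open>n = 0\<close> the second one yields only
  conjugates of \<open>g\<close> and its inverse.\<close>

lemma C_set_Suc:
  "x \<in> C_set G (Suc n) g \<longleftrightarrow>
     x = \<one>\<^bsub>G\<^esub> \<or> (\<exists>c\<in>conjugates_pm G g. \<exists>y\<in>C_set G n g. x = c \<otimes>\<^bsub>G\<^esub> y)"
proof
  assume "x \<in> C_set G (Suc n) g"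
  then obtain xs where xs: "x = foldr (\<otimes>\<^bsub>G\<^esub>) xs \<one>\<^bsub>G\<^esub>" "length xs \<le> Suc n"
      "set xs \<subseteq> conjugates_pm G g"
    by (auto simp: C_set_def)
  show "x = \<one>\<^bsub>G\<^esub> \<or> (\<exists>c\<in>conjugates_pm G g. \<exists>y\<in>C_set G n g. x = c \<otimes>\<^bsub>G\<^esub> y)"
    using xs by (cases xs) (auto simp: C_set_def)
next
  assume "x = \<one>\<^bsub>G\<^esub> \<or> (\<exists>c\<in>conjugates_pm G g. \<exists>y\<in>C_set G n g. x = c \<otimes>\<^bsub>G\<^esub> y)"
  then show "x \<in> C_set G (Suc n) g"
  proof
    assume "\<exists>c\<in>conjugates_pm G g. \<exists>y\<in>C_set G n g. x = c \<otimes>\<^bsub>G\<^esub> y"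
    then obtain c ys where "c \<in> conjugates_pm G g" "length ys \<le> n" "set ys \<subseteq> conjugates_pm G g"
        "x = c \<otimes>\<^bsub>G\<^esub> foldr (\<otimes>\<^bsub>G\<^esub>) ys \<one>\<^bsub>G\<^esub>"
      by (auto simp: C_set_def)
    then show ?thesis
      unfolding C_set_def by (intro CollectI exI[of _ "c # ys"]) simp
  qed (simp add: one_in_C_set)
qed

lemma C_set_mono: "m \<le> n \<Longrightarrow> C_set G m g \<subseteq> C_set G n g"
  by (force simp: C_set_def)

text \<open>Turns bounds in \<open>enat\<close> into statements about \<open>C_set\<close>; the
  value \<infinity> is covered, since the infimum of the empty set lies above every
  \<open>enat k\<close>.\<close>

lemma N_num_ge_iff:
  "enat k \<le> N_num G g \<longleftrightarrow> (\<forall>n<k. C_set G n g \<noteq> carrier G)"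
proof -
  have "enat k \<le> N_num G g \<longleftrightarrow> (\<forall>n. C_set G n g = carrier G \<longrightarrow> k \<le> n)"
    by (simp add: N_num_def le_Inf_iff setcompr_eq_image)
  then show ?thesis by (meson not_le)
qed

context group
begin

lemma mult_inv_cancel:
  assumes "x \<in> carrier G" "y \<in> carrier G"
  shows "x \<otimes> (inv x \<otimes> y) = y" "inv x \<otimes> (x \<otimes> y) = y"
  using assms by (simp_all flip: m_assoc)

lemma conjugates_pm_closed:
  assumes "g \<in> carrier G" "c \<in> conjugates_pm G g" shows "c \<in> carrier G"
  using assms by (auto elim!: conjugates_pmE)

lemma C_set_closed:
  assumes "g \<in> carrier G" "x \<in> C_set G n g" shows "x \<in> carrier G"
  using assms(2)
proof (induction n arbitrary: x)
  case (Suc n)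
  then show ?case
    using conjugates_pm_closed[OF assms(1)] by (auto simp: C_set_Suc)
qed (simp add: C_set_0)

lemma self_conjugates_pm: "g \<in> carrier G \<Longrightarrow> g \<in> conjugates_pm G g"
  using conjugates_pmI[of \<one> G g g] by simp

lemma conj_conjugates_pm:
  assumes "g \<in> carrier G" "h \<in> carrier G" "c \<in> conjugates_pm G g"
  shows "h \<otimes> c \<otimes> inv h \<in> conjugates_pm G g"
proof -
  obtain k x where k: "k \<in> carrier G" "x = g \<or> x = inv g" "c = k \<otimes> x \<otimes> inv k"
    using assms(3) by (rule conjugates_pmE)
  have x: "x \<in> carrier G" using k assms(1) by auto
  have "h \<otimes> c \<otimes> inv h = (h \<otimes> k) \<otimes> x \<otimes> inv (h \<otimes> k)"
    using k(1,3) x assms(2) by (simp add: inv_mult_group m_assoc)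
  then show ?thesis using k assms(2) conjugates_pmI[of "h \<otimes> k" G x g] by simp
qed

lemma inv_conjugates_pm:
  assumes "g \<in> carrier G" "c \<in> conjugates_pm G g"
  shows "inv c \<in> conjugates_pm G g"
proof -
  obtain k x where k: "k \<in> carrier G" "x = g \<or> x = inv g" "c = k \<otimes> x \<otimes> inv k"
    using assms(2) by (rule conjugates_pmE)
  have x: "x \<in> carrier G" using k assms(1) by auto
  have "inv c = k \<otimes> inv x \<otimes> inv k"
    using k(1,3) x by (simp add: inv_mult_group m_assoc)
  then show ?thesis using k assms(1) conjugates_pmI[of k G "inv x" g] by auto
qed

text \<open>Being conjugate to an element or to its inverse is an equivalence relation, and
  \<open>conjugates_pm\<close> gives its classes. Symmetry comes from undoing the conjugation by
  \<open>k\<close>.\<close>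

lemma conjugates_pm_cong:
  assumes g: "g \<in> carrier G" and c: "c \<in> conjugates_pm G g"
  shows "conjugates_pm G c = conjugates_pm G g"
proof -
  have sub: "conjugates_pm G b \<subseteq> conjugates_pm G a"
    if a: "a \<in> carrier G" and b: "b \<in> conjugates_pm G a" for a b
  proof
    fix d assume "d \<in> conjugates_pm G b"
    then obtain h x where hx: "h \<in> carrier G" "x = b \<or> x = inv b" "d = h \<otimes> x \<otimes> inv h"
      by (rule conjugates_pmE)
    then have "x \<in> conjugates_pm G a" using b inv_conjugates_pm[OF a b] by blast
    then show "d \<in> conjugates_pm G a" unfolding hx(3) by (rule conj_conjugates_pm[OF a hx(1)])
  qed
  obtain k x where k: "k \<in> carrier G" "x = g \<or> x = inv g" "c = k \<otimes> x \<otimes> inv k"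
    using c by (rule conjugates_pmE)
  have cc: "c \<in> carrier G" using conjugates_pm_closed[OF g c] .
  have x: "x \<in> carrier G" using k g by auto
  have "inv k \<otimes> c \<otimes> inv (inv k) = x"
    using k(1,3) x by (simp add: m_assoc mult_inv_cancel)
  then have "x \<in> conjugates_pm G c"
    using conjugates_pmI[of "inv k" G c c] k(1) by simp
  then have "g \<in> conjugates_pm G c"
    using k(2) inv_conjugates_pm[OF cc, of x] g by auto
  then show ?thesis using sub[OF cc] sub[OF g c] by blast
qed

lemma N_num_conjugates_pm:
  assumes "g \<in> carrier G" "c \<in> conjugates_pm G g"
  shows "N_num G c = N_num G g"
  by (simp add: N_num_def C_set_def conjugates_pm_cong[OF assms])

lemma C_set_mult:
  assumes g: "g \<in> carrier G" and x: "x \<in> C_set G m g" and y: "y \<in> C_set G n g"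
  shows "x \<otimes> y \<in> C_set G (m + n) g"
  using x
proof (induction m arbitrary: x)
  case 0
  then show ?case using y C_set_closed[OF g y] by (simp add: C_set_0)
next
  case (Suc m)
  from Suc.prems consider "x = \<one>"
    | c z where "c \<in> conjugates_pm G g" "z \<in> C_set G m g" "x = c \<otimes> z"
    by (auto simp: C_set_Suc)
  then show ?case
  proof cases
    case 1
    then show ?thesis
      using C_set_closed[OF g y] y C_set_mono[of n "Suc m + n" G g] by auto
  next
    case 2
    then have "x \<otimes> y = c \<otimes> (z \<otimes> y)"
      using conjugates_pm_closed[OF g] C_set_closed[OF g] y by (simp add: m_assoc)
    then show ?thesis
      using 2 Suc.IH[of z] by (auto simp: C_set_Suc)
  qed
qed

lemma conjugates_pm_subset_C_set_1:
  assumes "g \<in> carrier G" "c \<in> conjugates_pm G g" shows "c \<in> C_set G 1 g"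
proof -
  have "c = c \<otimes> \<one>" using conjugates_pm_closed[OF assms] by simp
  then have "c \<in> C_set G (Suc 0) g"
    using assms(2) unfolding C_set_Suc C_set_0 by blast
  then show ?thesis by simp
qed

lemma C_set_inv:
  assumes g: "g \<in> carrier G" and x: "x \<in> C_set G m g"
  shows "inv x \<in> C_set G m g"
  using x
proof (induction m arbitrary: x)
  case (Suc m)
  from Suc.prems consider "x = \<one>"
    | c z where "c \<in> conjugates_pm G g" "z \<in> C_set G m g" "x = c \<otimes> z"
    by (auto simp: C_set_Suc)
  then show ?case
  proof cases
    case 2
    then have "inv x = inv z \<otimes> inv c"
      using conjugates_pm_closed[OF g] C_set_closed[OF g] by (simp add: inv_mult_group)
    then show ?thesis
      using C_set_mult[OF g Suc.IH[OF 2(2)]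
          conjugates_pm_subset_C_set_1[OF g inv_conjugates_pm[OF g 2(1)]]] by simp
  qed (simp add: one_in_C_set)
qed (simp add: C_set_0)

lemma C_set_conj:
  assumes g: "g \<in> carrier G" and h: "h \<in> carrier G" and x: "x \<in> C_set G m g"
  shows "h \<otimes> x \<otimes> inv h \<in> C_set G m g"
  using x
proof (induction m arbitrary: x)
  case (Suc m)
  from Suc.prems consider "x = \<one>"
    | c z where "c \<in> conjugates_pm G g" "z \<in> C_set G m g" "x = c \<otimes> z"
    by (auto simp: C_set_Suc)
  then show ?case
  proof cases
    case 2
    have cz: "c \<in> carrier G" "z \<in> carrier G"
      using 2 conjugates_pm_closed[OF g] C_set_closed[OF g] by auto
    have "h \<otimes> x \<otimes> inv h = (h \<otimes> c \<otimes> inv h) \<otimes> (h \<otimes> z \<otimes> inv h)"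
      using cz h 2(3) by (simp add: m_assoc mult_inv_cancel)
    then show ?thesis
      using Suc.IH[OF 2(2)] conj_conjugates_pm[OF g h 2(1)] by (auto simp: C_set_Suc)
  qed (use h in \<open>simp add: one_in_C_set\<close>)
qed (use h in \<open>simp add: C_set_0\<close>)

text \<open>This union is the normal closure of \<open>g\<close>, the link between
  \<open>C_set\<close> and simplicity.\<close>

lemma normal_Union_C_set:
  assumes g: "g \<in> carrier G"
  shows "(\<Union>m. C_set G m g) \<lhd> G"
proof (rule normal_invI)
  show "subgroup (\<Union>m. C_set G m g) G"
  proof
    show "(\<Union>m. C_set G m g) \<subseteq> carrier G" using C_set_closed[OF g] by blast
    show "\<one> \<in> (\<Union>m. C_set G m g)" using one_in_C_set[of G 0] by blast
    show "x \<otimes> y \<in> (\<Union>m. C_set G m g)"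
      if "x \<in> (\<Union>m. C_set G m g)" "y \<in> (\<Union>m. C_set G m g)" for x y
      using that C_set_mult[OF g] by blast
    show "inv x \<in> (\<Union>m. C_set G m g)" if "x \<in> (\<Union>m. C_set G m g)" for x
      using that C_set_inv[OF g] by blast
  qed
  show "h \<otimes> x \<otimes> inv h \<in> (\<Union>m. C_set G m g)"
    if "x \<in> (\<Union>m. C_set G m g)" "h \<in> carrier G" for x h
    using that C_set_conj[OF g] by blast
qed

lemma simple_Union_C_set:
  assumes "is_simple G" and g: "g \<in> carrier G" "g \<noteq> \<one>"
  shows "(\<Union>m. C_set G m g) = carrier G"
proof -
  have "g \<in> (\<Union>m. C_set G m g)"
    using conjugates_pm_subset_C_set_1[OF g(1) self_conjugates_pm[OF g(1)]] by blast
  then show ?thesis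
    using assms normal_Union_C_set[OF g(1)] unfolding is_simple_def by (metis singletonD)
qed

text \<open>Hence in a nontrivial group \<open>N_num\<close> of the identity is \<infinity>, which
  settles the case of the empty product below.\<close>

lemma C_set_one: "C_set G m \<one> = {\<one>}"
proof (induction m)
  case (Suc m)
  have c: "c = \<one>" if "c \<in> conjugates_pm G \<one>" for c
    using that by (rule conjugates_pmE) auto
  have "x \<in> C_set G (Suc m) \<one> \<longleftrightarrow> x = \<one>" for x
    unfolding C_set_Suc Suc.IH by (auto dest!: c)
  then show ?case by blast
qed (simp add: C_set_0)

section \<open>Consequences of the star property\<close>

text \<open>Iterates the second clause of the star property along a product
  \<open>c \<otimes> z\<close>. The factor \<open>c\<close> has the same \<open>N_num\<close> as
  \<open>g\<close>; for \<open>z\<close> the induction hypothesis is used with the larger target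
  \<open>l\<close> that the clause demands, so \<open>k\<close> must stay arbitrary in the
  induction.\<close>

lemma star_property_C_set:
  assumes nt: "carrier G \<noteq> {\<one>}" and star: "star_property {G}"
  shows "\<exists>L. \<forall>g\<in>carrier G. enat L \<le> N_num G g \<longrightarrow> (\<forall>x\<in>C_set G m g. enat k \<le> N_num G x)"
proof (induction m arbitrary: k)
  case 0
  show ?case using nt by (auto simp: C_set_0 N_num_ge_iff C_set_one)
next
  case (Suc m)
  obtain l where l: "\<And>g h. \<lbrakk>g \<in> carrier G; h \<in> carrier G; enat l \<le> N_num G g; enat l \<le> N_num G h\<rbrakk>
      \<Longrightarrow> enat k \<le> N_num G (g \<otimes> h)"
    using star unfolding star_property_def by auto metis
  obtain L where L: "\<And>g x. \<lbrakk>g \<in> carrier G; enat L \<le> N_num G g; x \<in> C_set G m g\<rbrakk>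
      \<Longrightarrow> enat l \<le> N_num G x"
    using Suc.IH[of l] by blast
  have "enat k \<le> N_num G x"
    if g: "g \<in> carrier G" and ge: "enat (max l L) \<le> N_num G g" and x: "x \<in> C_set G (Suc m) g" for g x
  proof -
    have ge': "enat l \<le> N_num G g" "enat L \<le> N_num G g"
      using ge by (auto intro: order_trans[rotated])
    from x consider "x = \<one>"
      | c z where "c \<in> conjugates_pm G g" "z \<in> C_set G m g" "x = c \<otimes> z"
      by (auto simp: C_set_Suc)
    then show ?thesis
    proof cases
      case 1
      then show ?thesis using nt by (simp add: N_num_ge_iff C_set_one)
    next
      case 2
      then show ?thesis
        using l[of c z] L[OF g ge'(2)] N_num_conjugates_pm[OF g 2(1)] ge'(1)
          conjugates_pm_closed[OF g] C_set_closed[OF g] by simp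
    qed
  qed
  then show ?case by blast
qed

end

context metric_group
begin

text \<open>Every factor has the norm of \<open>g\<close>, so the triangle inequality suffices.
  Applied when \<open>C_set G n s\<close> is the whole group, this bounds the norm of
  \<open>s\<close> from below.\<close>

lemma nrm_C_set:
  assumes g: "g \<in> carrier G" and x: "x \<in> C_set G m g"
  shows "nrm x \<le> m * nrm g"
  using x
proof (induction m arbitrary: x)
  case 0
  then show ?case by (simp add: C_set_0 nrm_one)
next
  case (Suc m)
  from Suc.prems consider "x = \<one>"
    | c z where "c \<in> conjugates_pm G g" "z \<in> C_set G m g" "x = c \<otimes> z"
    by (auto simp: C_set_Suc)
  then show ?case
  proof cases
    case 1
    then show ?thesis using nrm_nonneg[OF g] by (simp add: nrm_one)
  next
    case 2
    have "nrm c = nrm g"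
      using 2(1) g by (auto elim!: conjugates_pmE simp: nrm_conj nrm_inv)
    moreover have "nrm x \<le> nrm c + nrm z"
      using nrm_mult[of c z] 2 conjugates_pm_closed[OF g] C_set_closed[OF g] by simp
    ultimately show ?thesis using Suc.IH[OF 2(2)] by (simp add: algebra_simps)
  qed
qed

text \<open>The order of quantifiers is the point: \<epsilon> is fixed before \<open>m\<close>, and
  only the threshold \<open>L\<close> depends on \<open>m\<close>.\<close>

lemma star_property_separation:
  assumes nt: "carrier G \<noteq> {\<one>}" and star: "star_property {G}"
  shows "\<exists>a\<in>carrier G. \<exists>\<epsilon>>0. \<forall>m. \<exists>L. \<forall>g\<in>carrier G. enat L \<le> N_num G g \<longrightarrow>
           (\<forall>x\<in>C_set G m g. \<epsilon> \<le> nrm (a \<otimes> inv x))"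
proof -
  obtain N a where a: "a \<in> carrier G" "C_set G N a = carrier G"
    using star unfolding star_property_def by auto
  have Na: "\<not> enat (Suc N) \<le> N_num G a" using a by (auto simp: N_num_ge_iff)
  obtain l where l: "\<And>g h. \<lbrakk>g \<in> carrier G; h \<in> carrier G; enat l \<le> N_num G g; enat l \<le> N_num G h\<rbrakk>
      \<Longrightarrow> enat (Suc N) \<le> N_num G (g \<otimes> h)"
    using star unfolding star_property_def by auto metis
  obtain b where b: "b \<in> carrier G" "b \<noteq> \<one>" using nt one_closed by blast
  have b0: "nrm b > 0" using nrm_nonneg[OF b(1)] nrm_eq_0_iff[OF b(1)] b(2) by linarith
  \<comment> \<open>Depends only on a fixed nontrivial \<open>b\<close> and on \<open>l\<close>. The
    successor keeps the denominator positive when \<open>l = 0\<close>.\<close>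
  define \<epsilon> where "\<epsilon> = nrm b / real (Suc l)"
  have "\<exists>L. \<forall>g\<in>carrier G. enat L \<le> N_num G g \<longrightarrow> (\<forall>x\<in>C_set G m g. \<epsilon> \<le> nrm (a \<otimes> inv x))" for m
  proof -
    obtain L where L: "\<And>g x. \<lbrakk>g \<in> carrier G; enat L \<le> N_num G g; x \<in> C_set G m g\<rbrakk>
        \<Longrightarrow> enat l \<le> N_num G x"
      using star_property_C_set[OF nt star, of m l] by blast
    have "\<epsilon> \<le> nrm (a \<otimes> inv x)"
      if g: "g \<in> carrier G" "enat L \<le> N_num G g" "x \<in> C_set G m g" for g x
    proof -
      have x: "x \<in> carrier G" using C_set_closed g by blast
      define s where "s = a \<otimes> inv x"
      have s: "s \<in> carrier G" "s \<otimes> x = a" using a x by (auto simp: s_def m_assoc)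
      \<comment> \<open>Otherwise \<open>s\<close> and \<open>x\<close> both reach the threshold
        \<open>l\<close>, and their product \<open>a\<close> would have \<open>N_num\<close> at
        least \<open>Suc N\<close>.\<close>
      have "\<not> enat l \<le> N_num G s" using l[OF s(1) x _ L[OF g]] Na s(2) by auto
      then obtain n where n: "n < l" "C_set G n s = carrier G" by (auto simp: N_num_ge_iff)
      have "nrm b \<le> n * nrm s" using nrm_C_set[OF s(1), of b n] n b by simp
      also have "\<dots> \<le> Suc l * nrm s"
        using n nrm_nonneg[OF s(1)] by (intro mult_right_mono) auto
      finally show ?thesis by (simp add: \<epsilon>_def s_def field_simps)
    qed
    then show ?thesis by blast
  qed
  moreover have "\<epsilon> > 0" using b0 by (simp add: \<epsilon>_def)
  ultimately show ?thesis using a by blast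
qed

end

section \<open>Ultrafilters\<close>

text \<open>If the singleton of \<open>i\<close> were \<open>U\<close>-large, \<open>U\<close> would
  be principal at \<open>i\<close>. So \<open>U\<close> avoids each point, hence each finite initial
  segment.\<close>

lemma nonprincipal_ultrafilter_eventually_ge:
  fixes U :: "nat filter"
  assumes "nonprincipal_ultrafilter U"
  shows "eventually (\<lambda>n. m \<le> n) U"
proof (rule ccontr)
  assume neg: "\<not> ?thesis"
  have U: "U \<noteq> bot" and alt: "\<And>P. eventually P U \<or> eventually (\<lambda>i. \<not> P i) U"
    using assms by (auto simp: nonprincipal_ultrafilter_def ultrafilter_def)
  have "eventually (\<lambda>n. n \<noteq> i) U" for i
  proof (rule ccontr)
    assume "\<not> ?thesis"
    then have i: "eventually (\<lambda>n. n = i) U" using alt[of "\<lambda>n. n = i"] by auto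
    have "eventually P U \<longleftrightarrow> P i" for P
    proof
      assume "eventually P U"
      then have "eventually (\<lambda>n. P n \<and> n = i) U" using i by (rule eventually_conj)
      then have "\<exists>n. P n \<and> n = i" by (rule eventually_happens'[OF U])
      then show "P i" by blast
    next
      assume "P i"
      then show "eventually P U" using i by (auto elim: eventually_mono)
    qed
    then have "U = principal {i}" by (simp add: filter_eq_iff eventually_principal)
    then show False using assms by (simp add: nonprincipal_ultrafilter_def)
  qed
  then have "eventually (\<lambda>n. \<forall>i\<in>{..<m}. n \<noteq> i) U" by (simp add: eventually_ball_finite)
  then have "eventually (\<lambda>n. m \<le> n) U" by (rule eventually_mono) force
  with neg show False ..
qed

text \<open>A form of countable saturation, without any monotonicity of \<open>X\<close> in
  \<open>k\<close>.\<close>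

lemma nonprincipal_ultrafilter_diagonal:
  fixes U :: "nat filter"
  assumes U: "nonprincipal_ultrafilter U" and X: "\<And>k. eventually (X k) U"
  shows "\<exists>s::nat \<Rightarrow> nat. \<forall>m. eventually (\<lambda>n. m \<le> s n \<and> X (s n) n) U"
proof -
  \<comment> \<open>The largest usable index at \<open>n\<close>; the bound \<open>k \<le> n\<close>
    makes the set finite. Where it is empty, \<open>Max\<close> is unspecified, but
    \<open>U\<close>-almost every \<open>n\<close> has \<open>m\<close> in the set.\<close>
  define s where "s n = Max {k. k \<le> n \<and> X k n}" for n
  have "eventually (\<lambda>n. m \<le> s n \<and> X (s n) n) U" for m
    using X[of m] nonprincipal_ultrafilter_eventually_ge[OF U, of m]
  proof eventually_elim
    case (elim n)
    have fin: "finite {k. k \<le> n \<and> X k n}" by simp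
    have "m \<in> {k. k \<le> n \<and> X k n}" using elim by simp
    then have "m \<le> s n" "s n \<in> {k. k \<le> n \<and> X k n}"
      unfolding s_def using Max_ge[OF fin] Max_in[OF fin] by blast+
    then show ?case by simp
  qed
  then show ?thesis by blast
qed

section \<open>The metric ultraproduct\<close>

declare carrier_product_group [simp del] mult_product_group [simp del]
  one_product_group [simp del] inv_product_group [simp del]

locale metric_group_sequence =
  fixes G :: "nat \<Rightarrow> ('a, 'b) monoid_scheme" and nrm :: "nat \<Rightarrow> 'a \<Rightarrow> real" and U :: "nat filter"
  assumes metric_group: "\<And>n. metric_group (G n) (nrm n)"
    and nrm_le_1: "\<And>n g. g \<in> carrier (G n) \<Longrightarrow> nrm n g \<le> 1"
    and ultra: "ultrafilter U"
begin

sublocale fac: metric_group "G n" "nrm n" for n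
  by (rule metric_group)

abbreviation "\<Pi>G \<equiv> product_group UNIV G"
abbreviation "P \<equiv> metric_ultraproduct G nrm U"
abbreviation "\<nu> \<equiv> metric_ultraproduct_norm nrm U"
abbreviation "\<N> \<equiv> null_sequences G nrm U"
abbreviation "cls g \<equiv> \<N> #>\<^bsub>\<Pi>G\<^esub> g"

sublocale prod: group \<Pi>G
  by (intro product_group fac.is_group)

lemma carrier_prod: "g \<in> carrier \<Pi>G \<longleftrightarrow> (\<forall>n. g n \<in> carrier (G n))"
  by (simp add: carrier_product_group PiE_iff)

lemma mult_prod: "g \<otimes>\<^bsub>\<Pi>G\<^esub> h = (\<lambda>n. g n \<otimes>\<^bsub>G n\<^esub> h n)"
  by (simp add: product_group_def restrict_def)

lemma one_prod: "\<one>\<^bsub>\<Pi>G\<^esub> = (\<lambda>n. \<one>\<^bsub>G n\<^esub>)"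
  by (simp add: product_group_def restrict_def)

lemma inv_prod: "g \<in> carrier \<Pi>G \<Longrightarrow> inv\<^bsub>\<Pi>G\<^esub> g = (\<lambda>n. inv\<^bsub>G n\<^esub> (g n))"
  by (rule prod.inv_equality) (auto simp: carrier_prod mult_prod one_prod)

lemma U_nonbot: "U \<noteq> bot"
  using ultra by (simp add: ultrafilter_def)

lemma ultra_cases: "eventually Q U \<or> eventually (\<lambda>i. \<not> Q i) U"
  using ultra by (simp add: ultrafilter_def)

lemma null_iff: "g \<in> carrier \<Pi>G \<Longrightarrow> g \<in> \<N> \<longleftrightarrow> ((\<lambda>n. nrm n (g n)) \<longlongrightarrow> 0) U"
  by (simp add: null_sequences_def)

text \<open>Conjugation invariance of the norms gives normality, and the triangle inequality
  squeezes the norm of a product to 0.\<close>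

lemma null_normal: "\<N> \<lhd> \<Pi>G"
proof (rule prod.normal_invI)
  show "subgroup \<N> \<Pi>G"
  proof
    show "\<N> \<subseteq> carrier \<Pi>G" by (auto simp: null_sequences_def)
    show "\<one>\<^bsub>\<Pi>G\<^esub> \<in> \<N>" by (simp add: null_sequences_def carrier_prod one_prod fac.nrm_one)
  next
    fix g h assume g: "g \<in> \<N>" and h: "h \<in> \<N>"
    have "((\<lambda>n. nrm n (g n) + nrm n (h n)) \<longlongrightarrow> 0 + 0) U"
      using g h by (intro tendsto_add) (auto simp: null_sequences_def)
    then have lim: "((\<lambda>n. nrm n (g n) + nrm n (h n)) \<longlongrightarrow> 0) U" by simp
    have c: "g n \<in> carrier (G n)" "h n \<in> carrier (G n)" for n
      using g h by (auto simp: null_sequences_def carrier_prod)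
    have "((\<lambda>n. nrm n (g n \<otimes>\<^bsub>G n\<^esub> h n)) \<longlongrightarrow> 0) U"
      by (rule tendsto_sandwich[OF _ _ tendsto_const lim])
        (simp_all add: c fac.nrm_mult fac.nrm_nonneg)
    then show "g \<otimes>\<^bsub>\<Pi>G\<^esub> h \<in> \<N>"
      using g h by (auto simp: null_sequences_def mult_prod carrier_prod)
  next
    fix g assume g: "g \<in> \<N>"
    then have c: "g \<in> carrier \<Pi>G" by (simp add: null_sequences_def)
    then show "inv\<^bsub>\<Pi>G\<^esub> g \<in> \<N>"
      using g by (simp add: null_sequences_def inv_prod fac.nrm_inv carrier_prod)
  qed
next
  fix g h assume h: "h \<in> \<N>" and g: "g \<in> carrier \<Pi>G"
  then show "g \<otimes>\<^bsub>\<Pi>G\<^esub> h \<otimes>\<^bsub>\<Pi>G\<^esub> inv\<^bsub>\<Pi>G\<^esub> g \<in> \<N>"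
    by (simp add: null_sequences_def inv_prod mult_prod fac.nrm_conj carrier_prod)
qed

sublocale norm: normal \<N> \<Pi>G
  by (rule null_normal)

lemma P_def: "P = \<Pi>G Mod \<N>"
  by (simp add: metric_ultraproduct_def)

sublocale quot: group P
  unfolding P_def by (rule norm.factorgroup_is_group)

lemma cls_hom: "cls \<in> hom \<Pi>G P"
  unfolding P_def by (rule norm.r_coset_hom_Mod)

lemma carrier_P: "carrier P = cls ` carrier \<Pi>G"
  by (auto simp: P_def carrier_FactGroup)

lemma cls_closed: "g \<in> carrier \<Pi>G \<Longrightarrow> cls g \<in> carrier P"
  by (auto simp: carrier_P)

lemma cls_mult: "g \<in> carrier \<Pi>G \<Longrightarrow> h \<in> carrier \<Pi>G \<Longrightarrow> cls g \<otimes>\<^bsub>P\<^esub> cls h = cls (g \<otimes>\<^bsub>\<Pi>G\<^esub> h)"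
  using cls_hom by (simp add: hom_mult[where h = cls])

lemma cls_one: "\<one>\<^bsub>P\<^esub> = cls \<one>\<^bsub>\<Pi>G\<^esub>"
  using hom_one[OF cls_hom prod.is_group quot.is_group] by simp

lemma cls_inv: "g \<in> carrier \<Pi>G \<Longrightarrow> inv\<^bsub>P\<^esub> cls g = cls (inv\<^bsub>\<Pi>G\<^esub> g)"
  using group_hom.hom_inv[OF group_hom.intro, OF prod.is_group quot.is_group] cls_hom
  by (simp add: group_hom_axioms_def)

lemma nu_cls: "g \<in> carrier \<Pi>G \<Longrightarrow> ((\<lambda>n. nrm n (g n)) \<longlongrightarrow> \<nu> (cls g)) U"
  by (rule metric_ultraproduct_norm_coset[OF metric_group nrm_le_1 ultra])

lemma cls_eq_one_iff:
  assumes "g \<in> carrier \<Pi>G" shows "cls g = \<one>\<^bsub>P\<^esub> \<longleftrightarrow> \<nu> (cls g) = 0"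
proof -
  have "\<one>\<^bsub>P\<^esub> = \<N>" by (simp add: P_def)
  then have "cls g = \<one>\<^bsub>P\<^esub> \<longleftrightarrow> g \<in> \<N>"
    using assms prod.coset_join1[of \<N> g] prod.coset_join2[of g \<N>] norm.is_subgroup by metis
  also have "\<dots> \<longleftrightarrow> ((\<lambda>n. nrm n (g n)) \<longlongrightarrow> 0) U"
    using assms by (rule null_iff)
  also have "\<dots> \<longleftrightarrow> \<nu> (cls g) = 0"
    using nu_cls[OF assms] tendsto_unique[OF U_nonbot nu_cls[OF assms], of 0] by metis
  finally show ?thesis .
qed

lemma nu_le:
  assumes "g \<in> carrier \<Pi>G" "eventually (\<lambda>n. nrm n (g n) \<le> b) U" shows "\<nu> (cls g) \<le> b"
  by (rule tendsto_upperbound[OF nu_cls[OF assms(1)] assms(2) U_nonbot])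

lemma nu_ge:
  assumes "g \<in> carrier \<Pi>G" "eventually (\<lambda>n. b \<le> nrm n (g n)) U" shows "b \<le> \<nu> (cls g)"
  by (rule tendsto_lowerbound[OF nu_cls[OF assms(1)] assms(2) U_nonbot])

text \<open>The norm axioms pass to limits along \<open>U\<close>, and dividing by \<N> makes the
  norm definite. This makes the results on \<open>metric_group\<close> available for
  \<open>P\<close>.\<close>

sublocale ultraproduct: metric_group P \<nu>
proof
  show one: "\<nu> \<one>\<^bsub>P\<^esub> = 0"
    using cls_eq_one_iff[of "\<one>\<^bsub>\<Pi>G\<^esub>"] by (simp add: cls_one)
  fix x y assume "x \<in> carrier P"
  then obtain g where g: "g \<in> carrier \<Pi>G" "x = cls g" by (auto simp: carrier_P)
  show "\<nu> x = 0 \<longleftrightarrow> x = \<one>\<^bsub>P\<^esub>" using cls_eq_one_iff g by simp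
  have "((\<lambda>n. nrm n ((inv\<^bsub>\<Pi>G\<^esub> g) n)) \<longlongrightarrow> \<nu> (cls g)) U"
    using nu_cls[OF g(1)] g(1) by (simp add: inv_prod fac.nrm_inv carrier_prod)
  then show "\<nu> (inv\<^bsub>P\<^esub> x) = \<nu> x"
    using tendsto_unique[OF U_nonbot nu_cls[of "inv\<^bsub>\<Pi>G\<^esub> g"]] g
    by (simp add: cls_inv)
  assume "y \<in> carrier P"
  then obtain h where h: "h \<in> carrier \<Pi>G" "y = cls h" by (auto simp: carrier_P)
  have "nrm n ((g \<otimes>\<^bsub>\<Pi>G\<^esub> h) n) \<le> nrm n (g n) + nrm n (h n)" for n
    using g(1) h(1) by (auto simp: mult_prod carrier_prod intro: fac.nrm_mult)
  then have "\<nu> (cls (g \<otimes>\<^bsub>\<Pi>G\<^esub> h)) \<le> \<nu> (cls g) + \<nu> (cls h)"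
    by (intro tendsto_le[OF U_nonbot tendsto_add[OF nu_cls[OF g(1)] nu_cls[OF h(1)]] nu_cls]
          prod.m_closed g(1) h(1)) simp
  then show "\<nu> (x \<otimes>\<^bsub>P\<^esub> y) \<le> \<nu> x + \<nu> y" using g h by (simp add: cls_mult)
  have "((\<lambda>n. nrm n ((h \<otimes>\<^bsub>\<Pi>G\<^esub> g \<otimes>\<^bsub>\<Pi>G\<^esub> inv\<^bsub>\<Pi>G\<^esub> h) n)) \<longlongrightarrow> \<nu> (cls g)) U"
    using nu_cls[OF g(1)] g(1) h(1) by (simp add: inv_prod mult_prod fac.nrm_conj carrier_prod)
  then show "\<nu> (y \<otimes>\<^bsub>P\<^esub> x \<otimes>\<^bsub>P\<^esub> inv\<^bsub>P\<^esub> y) = \<nu> x"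
    using tendsto_unique[OF U_nonbot nu_cls[of "h \<otimes>\<^bsub>\<Pi>G\<^esub> g \<otimes>\<^bsub>\<Pi>G\<^esub> inv\<^bsub>\<Pi>G\<^esub> h"]] g h
    by (simp add: cls_mult cls_inv)
qed

text \<open>Permits arbitrary default values off a \<open>U\<close>-large set: the quotient of the
  two sequences is trivial \<open>U\<close>-almost everywhere, so its class has norm 0.\<close>

lemma cls_eqI:
  assumes g: "g \<in> carrier \<Pi>G" and h: "h \<in> carrier \<Pi>G" and eq: "eventually (\<lambda>n. g n = h n) U"
  shows "cls g = cls h"
proof -
  have gh: "g \<otimes>\<^bsub>\<Pi>G\<^esub> inv\<^bsub>\<Pi>G\<^esub> h \<in> carrier \<Pi>G" using g h by simp
  have "eventually (\<lambda>n. nrm n ((g \<otimes>\<^bsub>\<Pi>G\<^esub> inv\<^bsub>\<Pi>G\<^esub> h) n) \<le> 0) U"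
    using eq by eventually_elim (use h in \<open>auto simp: mult_prod inv_prod fac.nrm_one carrier_prod\<close>)
  then have "\<nu> (cls (g \<otimes>\<^bsub>\<Pi>G\<^esub> inv\<^bsub>\<Pi>G\<^esub> h)) \<le> 0" by (rule nu_le[OF gh])
  then have "cls (g \<otimes>\<^bsub>\<Pi>G\<^esub> inv\<^bsub>\<Pi>G\<^esub> h) = \<one>\<^bsub>P\<^esub>"
    using ultraproduct.nrm_nonneg[OF cls_closed[OF gh]] cls_eq_one_iff[OF gh] by linarith
  then have "cls g \<otimes>\<^bsub>P\<^esub> inv\<^bsub>P\<^esub> cls h = \<one>\<^bsub>P\<^esub>"
    using g h by (simp add: cls_mult cls_inv)
  then show ?thesis
    using quot.inv_solve_right[of "\<one>\<^bsub>P\<^esub>" "cls g" "cls h"] g h cls_closed by simp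
qed

section \<open>Products of conjugates in the factors and in the ultraproduct\<close>

text \<open>One half of a transfer principle. The shape of the product may vary with
  \<open>n\<close>, but only finitely many shapes occur at each recursion step, so \<open>U\<close>
  selects one; the conjugators are then chosen coordinatewise.\<close>

lemma cls_C_set:
  assumes g: "g \<in> carrier \<Pi>G" and x: "x \<in> carrier \<Pi>G"
    and ev: "eventually (\<lambda>n. x n \<in> C_set (G n) m (g n)) U"
  shows "cls x \<in> C_set P m (cls g)"
  using x ev
proof (induction m arbitrary: x)
  case 0
  then have "cls x = cls \<one>\<^bsub>\<Pi>G\<^esub>"
    by (intro cls_eqI) (auto simp: C_set_0 one_prod carrier_prod)
  then show ?case by (simp add: cls_one C_set_0)
next
  case (Suc m)
  show ?case
  proof (cases "eventually (\<lambda>n. x n = \<one>\<^bsub>G n\<^esub>) U")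
    case True
    then have "cls x = cls \<one>\<^bsub>\<Pi>G\<^esub>"
      using Suc.prems by (intro cls_eqI) (auto simp: one_prod carrier_prod)
    then show ?thesis by (simp flip: cls_one add: one_in_C_set)
  next
    case False
    \<comment> \<open>\<open>Q n h y e\<close> splits off the first factor of \<open>x n\<close>:
      \<open>h\<close> conjugates \<open>e\<close>, which will be \<open>g n\<close> or its inverse,
      and \<open>y\<close> is the remaining product.\<close>
    define Q where "Q n h y e \<longleftrightarrow> h \<in> carrier (G n) \<and> y \<in> C_set (G n) m (g n) \<and>
      x n = h \<otimes>\<^bsub>G n\<^esub> e \<otimes>\<^bsub>G n\<^esub> inv\<^bsub>G n\<^esub> h \<otimes>\<^bsub>G n\<^esub> y" for n h y e
    have "eventually (\<lambda>n. x n \<noteq> \<one>\<^bsub>G n\<^esub>) U" using False ultra_cases by blast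
    then have "eventually (\<lambda>n. (\<exists>h y. Q n h y (g n)) \<or> (\<exists>h y. Q n h y (inv\<^bsub>G n\<^esub> g n))) U"
      using Suc.prems(2)
    proof eventually_elim
      case (elim n)
      then show ?case by (fastforce simp: C_set_Suc Q_def elim!: conjugates_pmE)
    qed
    then have "eventually (\<lambda>n. \<exists>h y. Q n h y (g n)) U \<or> eventually (\<lambda>n. \<exists>h y. Q n h y (inv\<^bsub>G n\<^esub> g n)) U"
      using ultra_cases[of "\<lambda>n. \<exists>h y. Q n h y (g n)"]
    proof (elim disjE)
      assume "eventually (\<lambda>n. (\<exists>h y. Q n h y (g n)) \<or> (\<exists>h y. Q n h y (inv\<^bsub>G n\<^esub> g n))) U"
        and "eventually (\<lambda>n. \<not> (\<exists>h y. Q n h y (g n))) U"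
      then have "eventually (\<lambda>n. \<exists>h y. Q n h y (inv\<^bsub>G n\<^esub> g n)) U"
        by eventually_elim blast
      then show ?thesis ..
    qed simp
    then obtain e where e: "e = g \<or> e = inv\<^bsub>\<Pi>G\<^esub> g" "eventually (\<lambda>n. \<exists>h y. Q n h y (e n)) U"
      using inv_prod[OF g] by fastforce
    have ec: "e \<in> carrier \<Pi>G" using e(1) g prod.inv_closed by blast
    \<comment> \<open>The default value keeps \<open>h\<close> and \<open>y\<close> in the carrier
      at every coordinate, so that they have classes in \<open>P\<close>.\<close>
    define h where "h n = (if \<exists>h y. Q n h y (e n) then SOME h. \<exists>y. Q n h y (e n) else \<one>\<^bsub>G n\<^esub>)" for n
    define y where "y n = (if \<exists>h y. Q n h y (e n) then SOME y. Q n (h n) y (e n) else \<one>\<^bsub>G n\<^esub>)" for n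
    have hyQ: "Q n (h n) (y n) (e n)" if "\<exists>h y. Q n h y (e n)" for n
    proof -
      have "\<exists>y. Q n (h n) y (e n)" unfolding h_def using that by simp (rule someI_ex)
      then show ?thesis unfolding y_def using that by simp (rule someI_ex)
    qed
    have hc: "h \<in> carrier \<Pi>G"
      unfolding carrier_prod
      using hyQ h_def Q_def by (metis fac.one_closed)
    have yc: "y \<in> carrier \<Pi>G"
      unfolding carrier_prod
      using hyQ y_def Q_def fac.C_set_closed g carrier_prod by (metis fac.one_closed)
    have ev: "eventually (\<lambda>n. Q n (h n) (y n) (e n)) U"
      by (rule eventually_mono[OF e(2) hyQ])
    have "cls x = cls (h \<otimes>\<^bsub>\<Pi>G\<^esub> e \<otimes>\<^bsub>\<Pi>G\<^esub> inv\<^bsub>\<Pi>G\<^esub> h \<otimes>\<^bsub>\<Pi>G\<^esub> y)"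
    proof (rule cls_eqI)
      show "eventually (\<lambda>n. x n = (h \<otimes>\<^bsub>\<Pi>G\<^esub> e \<otimes>\<^bsub>\<Pi>G\<^esub> inv\<^bsub>\<Pi>G\<^esub> h \<otimes>\<^bsub>\<Pi>G\<^esub> y) n) U"
        using ev by eventually_elim (simp add: mult_prod inv_prod[OF hc] Q_def)
    qed (use Suc.prems(1) hc ec yc in simp_all)
    also have "\<dots> = cls h \<otimes>\<^bsub>P\<^esub> cls e \<otimes>\<^bsub>P\<^esub> inv\<^bsub>P\<^esub> cls h \<otimes>\<^bsub>P\<^esub> cls y"
      using hc ec yc by (simp add: cls_mult cls_inv)
    finally have eq: "cls x = cls h \<otimes>\<^bsub>P\<^esub> cls e \<otimes>\<^bsub>P\<^esub> inv\<^bsub>P\<^esub> cls h \<otimes>\<^bsub>P\<^esub> cls y" .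
    have "cls h \<otimes>\<^bsub>P\<^esub> cls e \<otimes>\<^bsub>P\<^esub> inv\<^bsub>P\<^esub> cls h \<in> conjugates_pm P (cls g)"
      using e(1) cls_inv[OF g] by (intro conjugates_pmI cls_closed hc) auto
    moreover have "cls y \<in> C_set P m (cls g)"
      using ev by (intro Suc.IH yc) (auto simp: Q_def elim: eventually_mono)
    ultimately show ?thesis using eq by (auto simp: C_set_Suc)
  qed
qed

text \<open>The converse half. Conjugators and signs are fixed once in \<open>P\<close> and then
  read off from representatives, so membership holds at every \<open>n\<close>, not just
  \<open>U\<close>-almost everywhere.\<close>

lemma C_set_P_lift:
  assumes g: "g \<in> carrier \<Pi>G" and x: "x \<in> C_set P m (cls g)"
  shows "\<exists>y\<in>carrier \<Pi>G. x = cls y \<and> (\<forall>n. y n \<in> C_set (G n) m (g n))"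
  using x
proof (induction m arbitrary: x)
  case 0
  then show ?case by (intro bexI[of _ "\<one>\<^bsub>\<Pi>G\<^esub>"]) (auto simp: C_set_0 carrier_prod one_prod cls_one)
next
  case (Suc m)
  from Suc.prems consider "x = \<one>\<^bsub>P\<^esub>"
    | c z where "c \<in> conjugates_pm P (cls g)" "z \<in> C_set P m (cls g)" "x = c \<otimes>\<^bsub>P\<^esub> z"
    by (auto simp: C_set_Suc)
  then show ?case
  proof cases
    case 1
    then show ?thesis
      by (intro bexI[of _ "\<one>\<^bsub>\<Pi>G\<^esub>"]) (auto simp: carrier_prod one_prod cls_one one_in_C_set)
  next
    case 2
    obtain y where y: "y \<in> carrier \<Pi>G" "z = cls y" "\<And>n. y n \<in> C_set (G n) m (g n)"
      using Suc.IH[OF 2(2)] by blast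
    obtain h' e' where "h' \<in> carrier P" "e' = cls g \<or> e' = inv\<^bsub>P\<^esub> cls g"
        and c: "c = h' \<otimes>\<^bsub>P\<^esub> e' \<otimes>\<^bsub>P\<^esub> inv\<^bsub>P\<^esub> h'"
      using 2(1) by (rule conjugates_pmE)
    then obtain h e where h: "h \<in> carrier \<Pi>G" "h' = cls h" and e: "e = g \<or> e = inv\<^bsub>\<Pi>G\<^esub> g" "e' = cls e"
      using cls_inv[OF g] by (auto simp: carrier_P)
    have ec: "e \<in> carrier \<Pi>G" using e(1) g prod.inv_closed by blast
    define w where "w = h \<otimes>\<^bsub>\<Pi>G\<^esub> e \<otimes>\<^bsub>\<Pi>G\<^esub> inv\<^bsub>\<Pi>G\<^esub> h \<otimes>\<^bsub>\<Pi>G\<^esub> y"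
    have wc: "w \<in> carrier \<Pi>G"
      unfolding w_def using h ec y by (intro prod.m_closed prod.inv_closed)
    have "x = cls w"
      unfolding w_def 2(3) c h(2) e(2) y(2)
      using h(1) ec y(1) by (simp add: cls_mult cls_inv)
    moreover have "w n \<in> C_set (G n) (Suc m) (g n)" for n
    proof -
      have "h n \<otimes>\<^bsub>G n\<^esub> e n \<otimes>\<^bsub>G n\<^esub> inv\<^bsub>G n\<^esub> h n \<in> conjugates_pm (G n) (g n)"
        using e(1) h(1) inv_prod[OF g] by (intro conjugates_pmI) (auto simp: carrier_prod)
      moreover have "w n = h n \<otimes>\<^bsub>G n\<^esub> e n \<otimes>\<^bsub>G n\<^esub> inv\<^bsub>G n\<^esub> h n \<otimes>\<^bsub>G n\<^esub> y n"
        by (simp only: w_def mult_prod inv_prod[OF h(1)])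
      ultimately show ?thesis using y(3)[of n] by (auto simp: C_set_Suc)
    qed
    ultimately show ?thesis using wc by blast
  qed
qed

section \<open>Diagonal elements of the ultraproduct\<close>

text \<open>Merges the elements \<open>f k\<close> into one. In \<open>sep\<close> the index
  \<open>k\<close> is also the product length, so indices tending to infinity along \<open>U\<close>
  eventually handle every fixed length \<open>m\<close>.\<close>

lemma ultraproduct_diagonal:
  assumes np: "nonprincipal_ultrafilter U" and a: "a \<in> carrier P" and \<epsilon>: "\<epsilon> > 0"
    and f: "\<And>k. f k \<in> carrier P" "\<And>k. r < \<nu> (f k)"
    and sep: "\<And>k x. x \<in> C_set P k (f k) \<Longrightarrow> \<epsilon> \<le> \<nu> (a \<otimes>\<^bsub>P\<^esub> inv\<^bsub>P\<^esub> x)"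
  shows "\<exists>g\<in>carrier P. r \<le> \<nu> g \<and> (\<forall>m. a \<notin> C_set P m g)"
proof -
  obtain b where b: "b \<in> carrier \<Pi>G" "a = cls b" using a by (auto simp: carrier_P)
  have "\<forall>k. \<exists>u\<in>carrier \<Pi>G. f k = cls u" using f(1) by (auto simp: carrier_P)
  then obtain u where u: "\<And>k. u k \<in> carrier \<Pi>G" "\<And>k. f k = cls (u k)" by metis
  \<comment> \<open>Halving \<epsilon> leaves room to pass between a bound on the limit and bounds
    on the coordinates.\<close>
  define near where "near k n y \<longleftrightarrow> y \<in> C_set (G n) k (u k n) \<and> nrm n (b n \<otimes>\<^bsub>G n\<^esub> inv\<^bsub>G n\<^esub> y) \<le> \<epsilon> / 2"
    for k n y
  have far: "eventually (\<lambda>n. r < nrm n (u k n) \<and> \<not> (\<exists>y. near k n y)) U" for k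
  proof (rule eventually_conj)
    show "eventually (\<lambda>n. r < nrm n (u k n)) U"
      using order_tendstoD(1)[OF nu_cls[OF u(1)]] f(2) u(2) by simp
    \<comment> \<open>Otherwise near elements exist \<open>U\<close>-almost everywhere and assemble
      to a member of \<open>C_set P k (f k)\<close> at distance at most \<epsilon>/2 from
      \<open>a\<close>, against \<open>sep\<close>. The default \<open>\<one>\<close> in
      \<open>y\<close> lies in every \<open>C_set\<close>.\<close>
    show "eventually (\<lambda>n. \<not> (\<exists>y. near k n y)) U"
    proof (rule ccontr)
      assume "\<not> ?thesis"
      then have ev: "eventually (\<lambda>n. \<exists>y. near k n y) U" using ultra_cases by blast
      define y where "y n = (if \<exists>y. near k n y then SOME y. near k n y else \<one>\<^bsub>G n\<^esub>)" for n
      have near: "near k n (y n)" if "\<exists>y. near k n y" for n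
        unfolding y_def using that by simp (rule someI_ex)
      have yC: "y n \<in> C_set (G n) k (u k n)" for n
        using near[of n] by (cases "\<exists>y. near k n y") (auto simp: near_def y_def one_in_C_set)
      have yc: "y \<in> carrier \<Pi>G"
        unfolding carrier_prod using yC fac.C_set_closed u(1) carrier_prod by blast
      have "cls y \<in> C_set P k (f k)"
        unfolding u(2) using yC by (intro cls_C_set u(1) yc) simp
      then have "\<epsilon> \<le> \<nu> (cls (b \<otimes>\<^bsub>\<Pi>G\<^esub> inv\<^bsub>\<Pi>G\<^esub> y))"
        using sep[of "cls y" k] b yc by (simp add: cls_mult cls_inv)
      also have "\<dots> \<le> \<epsilon> / 2"
        using ev near
        by (intro nu_le prod.m_closed prod.inv_closed b yc)
          (auto simp: mult_prod inv_prod[OF yc] near_def elim!: eventually_mono)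
      finally show False using \<epsilon> by simp
    qed
  qed
  obtain s where s: "\<And>m. eventually (\<lambda>n. m \<le> s n \<and> r < nrm n (u (s n) n) \<and> \<not> (\<exists>y. near (s n) n y)) U"
    using nonprincipal_ultrafilter_diagonal[OF np,
        of "\<lambda>k n. r < nrm n (u k n) \<and> \<not> (\<exists>y. near k n y)"] far by blast
  define g where "g n = u (s n) n" for n
  have gc: "g \<in> carrier \<Pi>G" using u(1) by (auto simp: carrier_prod g_def)
  \<comment> \<open>The strict inequality at the coordinates becomes a weak one in the
    limit.\<close>
  have "r \<le> \<nu> (cls g)"
    using s[of 0] by (intro nu_ge gc) (auto simp: g_def elim: eventually_mono)
  moreover have "a \<notin> C_set P m (cls g)" for m
  proof
    assume "a \<in> C_set P m (cls g)"
    then obtain y where y: "y \<in> carrier \<Pi>G" "a = cls y" "\<And>n. y n \<in> C_set (G n) m (g n)"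
      using C_set_P_lift[OF gc] by blast
    \<comment> \<open>Where \<open>m \<le> s n\<close>, the coordinate \<open>y n\<close> is also a
      product of length at most \<open>s n\<close>, and it is not near \<open>b n\<close>.\<close>
    have "eventually (\<lambda>n. \<epsilon> / 2 \<le> nrm n ((b \<otimes>\<^bsub>\<Pi>G\<^esub> inv\<^bsub>\<Pi>G\<^esub> y) n)) U"
      using s[of m]
    proof eventually_elim
      case (elim n)
      then have "y n \<in> C_set (G n) (s n) (u (s n) n)"
        using y(3)[of n] C_set_mono[of m "s n" "G n" "g n"] by (auto simp: g_def)
      then show ?case using elim by (force simp: near_def mult_prod inv_prod[OF y(1)])
    qed
    then have "\<epsilon> / 2 \<le> \<nu> (cls (b \<otimes>\<^bsub>\<Pi>G\<^esub> inv\<^bsub>\<Pi>G\<^esub> y))"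
      by (intro nu_ge prod.m_closed prod.inv_closed b y(1))
    also have "cls (b \<otimes>\<^bsub>\<Pi>G\<^esub> inv\<^bsub>\<Pi>G\<^esub> y) = cls b \<otimes>\<^bsub>P\<^esub> inv\<^bsub>P\<^esub> cls y"
      using b(1) y(1) by (simp add: cls_mult cls_inv)
    \<comment> \<open>Both \<open>b\<close> and \<open>y\<close> represent \<open>a\<close>, so the
      norm bounded below by \<epsilon>/2 is that of the identity.\<close>
    also have "\<dots> = a \<otimes>\<^bsub>P\<^esub> inv\<^bsub>P\<^esub> a"
      by (simp only: b(2)[symmetric] y(2)[symmetric])
    finally show False using a \<epsilon> by (simp add: ultraproduct.nrm_one)
  qed
  ultimately show ?thesis using cls_closed[OF gc] by blast
qed

end

theorem theorem8p13:
  fixes G :: "nat \<Rightarrow> ('a, 'b) monoid_scheme"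
    and nrm :: "nat \<Rightarrow> 'a \<Rightarrow> real"
    and U :: "nat filter"
  assumes "\<And>n. metric_group (G n) (nrm n)"
    and "\<And>n g. g \<in> carrier (G n) \<Longrightarrow> nrm n g \<le> 1"
    and "nonprincipal_ultrafilter U"
    and "is_simple (metric_ultraproduct G nrm U)"
    and "star_property {metric_ultraproduct G nrm U}"
  shows "metrically_uniformly_simple (metric_ultraproduct G nrm U) (metric_ultraproduct_norm nrm U)"
proof -
  interpret metric_group_sequence G nrm U
    using assms by (intro metric_group_sequence.intro) (auto simp: nonprincipal_ultrafilter_def)
  have nt: "carrier P \<noteq> {\<one>\<^bsub>P\<^esub>}" using assms(4) by (simp add: is_simple_def)
  obtain a \<epsilon> where a: "a \<in> carrier P" and \<epsilon>: "\<epsilon> > 0"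
    and "\<forall>m. \<exists>L. \<forall>g\<in>carrier P. enat L \<le> N_num P g \<longrightarrow>
           (\<forall>x\<in>C_set P m g. \<epsilon> \<le> \<nu> (a \<otimes>\<^bsub>P\<^esub> inv\<^bsub>P\<^esub> x))"
    using ultraproduct.star_property_separation[OF nt assms(5)] by blast
  then obtain L where L: "\<And>m g x. \<lbrakk>g \<in> carrier P; enat (L m) \<le> N_num P g; x \<in> C_set P m g\<rbrakk>
      \<Longrightarrow> \<epsilon> \<le> \<nu> (a \<otimes>\<^bsub>P\<^esub> inv\<^bsub>P\<^esub> x)"
    by metis
  show ?thesis
    unfolding metrically_uniformly_simple_def
  proof (intro allI impI, rule ccontr)
    fix t r :: real
    assume tr: "t > r \<and> r > 0"
    assume "\<nexists>N. \<forall>g\<in>carrier P. \<nu> g \<in> {r<..t} \<longrightarrow> {h \<in> carrier P. \<nu> h < t} \<subseteq> C_set P N g"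
    \<comment> \<open>The negated claim is used at \<open>N = L k\<close>: some element of the ball
      escapes \<open>C_set P (L k) g\<close>, which is therefore not all of \<open>P\<close>. By
      monotonicity no shorter length gives all of \<open>P\<close> either, whence
      \<open>ge\<close>.\<close>
    then have "\<forall>k. \<exists>g. g \<in> carrier P \<and> r < \<nu> g \<and> \<not> carrier P \<subseteq> C_set P (L k) g"
      by (smt (verit, ccfv_threshold) greaterThanAtMost_iff mem_Collect_eq subset_iff)
    then obtain f where f: "\<And>k. f k \<in> carrier P" "\<And>k. r < \<nu> (f k)"
        "\<And>k. \<not> carrier P \<subseteq> C_set P (L k) (f k)"
      by metis
    have ge: "enat (L k) \<le> N_num P (f k)" for k
      unfolding N_num_ge_iff
    proof (intro allI impI notI)
      fix n assume "n < L k" and eq: "C_set P n (f k) = carrier P"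
      then have "C_set P n (f k) \<subseteq> C_set P (L k) (f k)" by (intro C_set_mono) simp
      then show False using f(3)[of k] unfolding eq by contradiction
    qed
    have "\<epsilon> \<le> \<nu> (a \<otimes>\<^bsub>P\<^esub> inv\<^bsub>P\<^esub> x)" if "x \<in> C_set P k (f k)" for k x
      by (rule L[OF f(1) ge that])
    then have "\<exists>g\<in>carrier P. r \<le> \<nu> g \<and> (\<forall>m. a \<notin> C_set P m g)"
      by (rule ultraproduct_diagonal[where f = f, OF assms(3) a \<epsilon> f(1,2)])
    then obtain g where g: "g \<in> carrier P" "r \<le> \<nu> g" "\<forall>m. a \<notin> C_set P m g"
      by (elim bexE conjE)
    \<comment> \<open>Here \<open>r > 0\<close> enters. By simplicity the products of conjugates of
      \<open>g\<close> then exhaust \<open>P\<close>, yet they all miss \<open>a\<close>.\<close>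
    have "g \<noteq> \<one>\<^bsub>P\<^esub>" using g(2) tr ultraproduct.nrm_one by auto
    then show False
      using quot.simple_Union_C_set[OF assms(4) g(1)] g(3) a by (metis UN_iff)
  qed
qed

end
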